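(* Let $\{M_0(t)\}_{t\ge0}$ and $\{M(t)\}_{t\ge0}$ be independent generalized counting processes with positive rates $\mu_1,\dots,\mu_{k_0}$ and $\lambda_1,\dots,\lambda_k$, respectively, and let $\hat M(t)=M(M_0(t))$. Let $X_1,X_2,\dots$ be i.i.d. random variables, independent of $\{\hat M(t)\}_{t\ge0}$, with $\mathrm{Pr}\{X_1=i\}=\alpha_i$, $i=0,1,2,\dots$, and let $D(t)=\sum_{i=1}^{\hat M(t)}X_i$. Then the probability generating function $\hat G_{D(t)}(u)=\mathbb{E}(u^{D(t)})$ is given by $$\hat G_{D(t)}(u)=\exp\Big(-t\sum_{j_0=1}^{k_0}\mu_{j_0}\Big(1-\exp\Big(-j_0\sum_{j=1}^{k}\lambda_j\sum_{i=1}^{\infty}\alpha_i^{*(j)}(1-u^i)\Big)\Big)\Big),\qquad|u|\le1,$$ where $\alpha_i^{*(j)}=\sum_{r_1+\dots+r_j=i,\ r_m\in\mathbb{N}_0}\alpha_{r_1}\alpha_{r_2}\cdots\alpha_{r_j}$.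
   Context: A generalized counting process (GCP) $\{M(t)\}_{t\ge0}$ with positive rates $\lambda_1,\dots,\lambda_k$ is a right-continuous $\mathbb{N}_0$-valued process with $M(0)=0$ and stationary independent increments, whose probability generating function is $\mathbb{E}(u^{M(t)})=\exp\big(-t\sum_{j=1}^{k}\lambda_j(1-u^j)\big)$, $|u|\le1$. The process $\hat M(t)=M(M_0(t))$ is the iterated generalized counting process (IGCP). *)

theory Defs
  imports "HOL-Probability.Probability"
begin

definition pgf :: "'a measure \<Rightarrow> ('a \<Rightarrow> nat) \<Rightarrow> complex \<Rightarrow> complex" where
  "pgf P Y u = (\<integral>\<omega>. u ^ Y \<omega> \<partial>P)"

text \<open>Increments are taken in the integers because subtraction on the naturals truncates
  and monotone paths are not part of the definition.\<close>

definition increment :: "(real \<Rightarrow> 'a \<Rightarrow> nat) \<Rightarrow> real \<Rightarrow> real \<Rightarrow> 'a \<Rightarrow> int" where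
  "increment M s t \<omega> = int (M t \<omega>) - int (M s \<omega>)"

definition stationary_increments :: "'a measure \<Rightarrow> (real \<Rightarrow> 'a \<Rightarrow> nat) \<Rightarrow> bool" where
  "stationary_increments P M \<longleftrightarrow>
     (\<forall>s\<ge>0. \<forall>h\<ge>0. distr P (count_space UNIV) (increment M s (s + h)) =
                   distr P (count_space UNIV) (increment M 0 h))"

definition independent_increments :: "'a measure \<Rightarrow> (real \<Rightarrow> 'a \<Rightarrow> nat) \<Rightarrow> bool" where
  "independent_increments P M \<longleftrightarrow>
     (\<forall>(n::nat) \<tau>. 0 \<le> \<tau> 0 \<and> (\<forall>i<n. \<tau> i \<le> \<tau> (Suc i)) \<longrightarrow>
        prob_space.indep_vars P (\<lambda>_. count_space UNIV)
          (\<lambda>i. increment M (\<tau> i) (\<tau> (Suc i))) {..<n})"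

text \<open>Only times \<open>t \<ge> 0\<close> and rates \<open>l 1, \<dots>, l k\<close> are relevant. The path properties
  are required almost surely.\<close>

definition generalized_counting_process ::
  "'a measure \<Rightarrow> nat \<Rightarrow> (nat \<Rightarrow> real) \<Rightarrow> (real \<Rightarrow> 'a \<Rightarrow> nat) \<Rightarrow> bool" where
  "generalized_counting_process P k l M \<longleftrightarrow>
     1 \<le> k \<and> (\<forall>j\<in>{1..k}. 0 < l j) \<and>
     (\<forall>t\<ge>0. M t \<in> measurable P (count_space UNIV)) \<and>
     (AE \<omega> in P. M 0 \<omega> = 0) \<and>
     (AE \<omega> in P. \<forall>t\<ge>0. ((\<lambda>s. M s \<omega>) \<longlongrightarrow> M t \<omega>) (at_right t)) \<and>
     stationary_increments P M \<and>
     independent_increments P M \<and>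
     (\<forall>t\<ge>0. \<forall>u::complex. norm u \<le> 1 \<longrightarrow>
        pgf P (M t) u = exp (- of_real t * (\<Sum>j=1..k. of_real (l j) * (1 - u ^ j))))"

definition iterated_process ::
  "(real \<Rightarrow> 'a \<Rightarrow> nat) \<Rightarrow> (real \<Rightarrow> 'a \<Rightarrow> nat) \<Rightarrow> real \<Rightarrow> 'a \<Rightarrow> nat" where
  "iterated_process M M0 t \<omega> = M (real (M0 t \<omega>)) \<omega>"

text \<open>The sigma-algebra generated by the family of random variables \<open>Y t\<close>, \<open>t \<in> T\<close>.\<close>

definition generated_events :: "'a measure \<Rightarrow> 't set \<Rightarrow> ('t \<Rightarrow> 'a \<Rightarrow> nat) \<Rightarrow> 'a set set" where
  "generated_events P T Y = sigma_sets (space P) {Y t -` A \<inter> space P | t A. t \<in> T}"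

definition independent_families ::
  "'a measure \<Rightarrow> 's set \<Rightarrow> ('s \<Rightarrow> 'a \<Rightarrow> nat) \<Rightarrow> 't set \<Rightarrow> ('t \<Rightarrow> 'a \<Rightarrow> nat) \<Rightarrow> bool" where
  "independent_families P S Y T Z \<longleftrightarrow>
     prob_space.indep_set P (generated_events P S Y) (generated_events P T Z)"

text \<open>Independent identically distributed variables \<open>X 1, X 2, \<dots>\<close>; the value \<open>X 0\<close> is unused.\<close>

definition iid :: "'a measure \<Rightarrow> (nat \<Rightarrow> 'a \<Rightarrow> nat) \<Rightarrow> bool" where
  "iid P X \<longleftrightarrow>
     prob_space.indep_vars P (\<lambda>_. count_space UNIV) X {1..} \<and>
     (\<forall>i\<ge>1. distr P (count_space UNIV) (X i) = distr P (count_space UNIV) (X 1))"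

definition weak_compositions :: "nat \<Rightarrow> nat \<Rightarrow> (nat \<Rightarrow> nat) set" where
  "weak_compositions j i = {r \<in> {1..j} \<rightarrow>\<^sub>E UNIV. (\<Sum>m=1..j. r m) = i}"

lemma finite_weak_compositions: "finite (weak_compositions j i)"
proof (rule finite_subset)
  show "weak_compositions j i \<subseteq> {1..j} \<rightarrow>\<^sub>E {..i}"
  proof
    fix r assume r: "r \<in> weak_compositions j i"
    have "r m \<le> i" if "m \<in> {1..j}" for m
    proof -
      have "r m \<le> (\<Sum>m=1..j. r m)" using that by (intro member_le_sum) auto
      with r show ?thesis by (simp add: weak_compositions_def)
    qed
    with r show "r \<in> {1..j} \<rightarrow>\<^sub>E {..i}" by (auto simp: weak_compositions_def PiE_iff)
  qed
  show "finite ({1..j} \<rightarrow>\<^sub>E {..i})" by (intro finite_PiE) auto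
qed

definition conv_power :: "(nat \<Rightarrow> real) \<Rightarrow> nat \<Rightarrow> nat \<Rightarrow> real" where
  "conv_power \<alpha> j i = (\<Sum>r\<in>weak_compositions j i. \<Prod>m=1..j. \<alpha> (r m))"

end

theory Submission
  imports Defs
begin

text \<open>If \<open>N\<close> is independent of each \<open>S n\<close> and \<open>E(u ^ S n) = w ^ n\<close>, then conditioning on \<open>N\<close>
  gives \<open>E(u ^ S N) = E(w ^ N)\<close>. This applies twice: to \<open>S n = X 1 + \<dots> + X n\<close>, where
  \<open>w = g = E(u ^ X 1)\<close>, and to \<open>S n = M(n)\<close>, where \<open>w = E(g ^ M(1))\<close>. Finally \<open>g ^ j\<close> is the
  generating function of \<open>conv_power \<alpha> j\<close>, whose total mass is \<open>1\<close>.\<close>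

section \<open>Measurability for discrete values and for generated sigma-algebras\<close>

lemma measurable_power_count_space:
  fixes u :: complex
  assumes "Y \<in> measurable P (count_space UNIV)"
  shows "(\<lambda>\<omega>. u ^ Y \<omega>) \<in> borel_measurable P"
  by (rule measurable_compose[OF assms]) simp

text \<open>On the naturals the discrete and the Borel sigma-algebra coincide, so Borel
  measurability of sums carries over. The measure \<open>Q\<close> is arbitrary because the lemma
  serves both the probability space itself and the sigma-algebra generated by
  \<open>X\<close>.\<close>

lemma measurable_sum_count_space:
  fixes f :: "'i \<Rightarrow> 'a \<Rightarrow> nat"
  assumes "\<And>i. i \<in> I \<Longrightarrow> f i \<in> measurable Q (count_space UNIV)"
  shows "(\<lambda>\<omega>. \<Sum>i\<in>I. f i \<omega>) \<in> measurable Q (count_space UNIV)"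
proof -
  have eq: "measurable Q (count_space (UNIV :: nat set)) = borel_measurable Q"
    by (rule measurable_cong_sets) (simp_all add: sets_borel_eq_count_space)
  show ?thesis
    using assms unfolding eq by (rule borel_measurable_sum)
qed

lemma measurable_sigma_family:
  assumes "i \<in> I"
  shows "Y i \<in> measurable (sigma \<Omega> {Y i -` A \<inter> \<Omega> | i A. i \<in> I}) (count_space UNIV)"
proof -
  have sub: "{Y i -` A \<inter> \<Omega> | i A. i \<in> I} \<subseteq> Pow \<Omega>" by blast
  show ?thesis
    using assms by (intro measurableI) (auto simp only: sets_measure_of[OF sub] space_measure_of[OF sub]
        space_count_space intro!: sigma_sets.Basic)
qed

lemma vimage_in_generated_events:
  assumes "h \<in> measurable (sigma (space P) {Y i -` A \<inter> space P | i A. i \<in> I}) (count_space UNIV)"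
  shows "h -` A \<inter> space P \<in> generated_events P I Y"
proof -
  have sub: "{Y i -` A \<inter> space P | i A. i \<in> I} \<subseteq> Pow (space P)" by blast
  from measurable_sets[OF assms, of A] show ?thesis
    unfolding sets_measure_of[OF sub] space_measure_of[OF sub] generated_events_def by simp
qed

text \<open>This lets independence of two families pass to any discrete variables computed from
  them, such as partial sums.\<close>

lemma sigma_sets_vimage_subset_generated_events:
  assumes "h \<in> measurable (sigma (space P) {Y i -` A \<inter> space P | i A. i \<in> I}) (count_space UNIV)"
  shows "sigma_sets (space P) {h -` A \<inter> space P | A. A \<in> sets (count_space UNIV)}
    \<subseteq> generated_events P I Y"
  unfolding generated_events_def
  by (rule sigma_sets_mono)
    (use vimage_in_generated_events[OF assms] in \<open>auto simp: generated_events_def\<close>)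

section \<open>Generating functions at a random index\<close>

context prob_space
begin

text \<open>Ensures that a value of a generating function can itself be inserted as the argument of
  another one, which the nested composition requires.\<close>

lemma norm_expectation_power_le_1:
  fixes u :: complex
  assumes "norm u \<le> 1"
  shows "norm (\<integral>\<omega>. u ^ Y \<omega> \<partial>M) \<le> 1"
proof (cases "integrable M (\<lambda>\<omega>. u ^ Y \<omega>)")
  case True
  have "norm (\<integral>\<omega>. u ^ Y \<omega> \<partial>M) \<le> (\<integral>\<omega>. norm (u ^ Y \<omega>) \<partial>M)"
    by (rule integral_norm_bound)
  also have "\<dots> \<le> (\<integral>\<omega>. 1 \<partial>M)"
    using assms True by (intro integral_mono integrable_norm) (auto simp: norm_power power_le_one)
  finally show ?thesis by (simp add: prob_space)
\<comment> \<open>The Bochner integral of a non-integrable function is 0 by convention.\<close>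
qed (simp add: not_integrable_integral_eq)

lemma integrable_power:
  fixes u :: complex
  assumes "Y \<in> measurable M (count_space UNIV)" "norm u \<le> 1"
  shows "integrable M (\<lambda>\<omega>. u ^ Y \<omega>)"
  using assms
  by (intro integrable_const_bound[where B = 1] measurable_power_count_space)
    (auto simp: norm_power power_le_one)

text \<open>Split the expectation over the events \<open>N = n\<close>. On each of them only
  \<open>S n\<close> occurs, so independence of \<open>N\<close> from each single \<open>S n\<close>
  is enough, whatever the joint law of the \<open>S n\<close>.\<close>

lemma random_index_sums:
  fixes u :: complex and N :: "'a \<Rightarrow> nat" and S :: "nat \<Rightarrow> 'a \<Rightarrow> nat"
  assumes indep: "\<And>n. indep_var (count_space UNIV) N (count_space UNIV) (S n)"
    and u: "norm u \<le> 1"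
  shows "(\<lambda>n. of_real (prob {\<omega> \<in> space M. N \<omega> = n}) * (\<integral>\<omega>. u ^ S n \<omega> \<partial>M))
           sums (\<integral>\<omega>. u ^ S (N \<omega>) \<omega> \<partial>M)"
proof -
  have N [measurable]: "N \<in> measurable M (count_space UNIV)"
    and S [measurable]: "S n \<in> measurable M (count_space UNIV)" for n
    using indep by (auto simp: indep_var_eq)
  define f :: "nat \<Rightarrow> 'a \<Rightarrow> complex" where "f n \<omega> = indicator {n} (N \<omega>) * u ^ S n \<omega>" for n \<omega>
  have fmeas [measurable]: "f n \<in> borel_measurable M" for n
    unfolding f_def
    by (intro borel_measurable_times measurable_power_count_space[OF S] measurable_compose[OF N]) simp
  have bound: "norm (f n \<omega>) \<le> indicator {\<omega> \<in> space M. N \<omega> = n} \<omega>" if "\<omega> \<in> space M" for n \<omega>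
    using u that by (auto simp: f_def norm_mult norm_power power_le_one indicator_def)
  have int: "integrable M (f n)" for n
    using u by (intro integrable_const_bound[where B = 1])
      (auto simp: f_def norm_mult norm_power power_le_one indicator_def)
  have norm_le: "(\<integral>\<omega>. norm (f n \<omega>) \<partial>M) \<le> prob {\<omega> \<in> space M. N \<omega> = n}" for n
  proof -
    have "(\<integral>\<omega>. norm (f n \<omega>) \<partial>M) \<le> (\<integral>\<omega>. indicator {\<omega> \<in> space M. N \<omega> = n} \<omega> \<partial>M)"
      using bound by (intro integral_mono integrable_norm int integrable_real_indicator)
        (auto simp: emeasure_eq_measure)
    also have "\<dots> = prob {\<omega> \<in> space M. N \<omega> = n}"
      by (simp add: Int_absorb2 subset_eq)
    finally show ?thesis .
  qed
  \<comment> \<open>The probabilities of the disjoint events \<open>N = n\<close> form a summable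
    majorant of the L1 norms of \<open>f n\<close>; this justifies exchanging series and
    integral.\<close>
  have "(\<lambda>n. prob {\<omega> \<in> space M. N \<omega> = n}) sums prob (\<Union>n. {\<omega> \<in> space M. N \<omega> = n})"
    by (intro finite_measure_UNION) (auto simp: disjoint_family_on_def)
  then have "summable (\<lambda>n. prob {\<omega> \<in> space M. N \<omega> = n})"
    by (rule sums_summable)
  then have sum2: "summable (\<lambda>n. \<integral>\<omega>. norm (f n \<omega>) \<partial>M)"
    by (rule summable_comparison_test') (use norm_le in auto)
  \<comment> \<open>Pointwise, only the term with index \<open>N \<omega>\<close> is
    nonzero.\<close>
  have single: "(\<lambda>n. f n \<omega>) sums (u ^ S (N \<omega>) \<omega>)" for \<omega>
    using sums_single[of "N \<omega>" "\<lambda>n. u ^ S n \<omega>"]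
    by (rule sums_cong[THEN iffD1, rotated]) (auto simp: f_def indicator_def)
  have "summable (\<lambda>n. norm (f n \<omega>))" for \<omega>
    by (rule summable_finite[of "{N \<omega>}"]) (auto simp: f_def indicator_def)
  then have "(\<lambda>n. integral\<^sup>L M (f n)) sums (\<integral>\<omega>. (\<Sum>n. f n \<omega>) \<partial>M)"
    using int sum2 by (intro sums_integral) auto
  moreover have "(\<Sum>n. f n \<omega>) = u ^ S (N \<omega>) \<omega>" for \<omega>
    using single by (rule sums_unique[symmetric])
  moreover have "integral\<^sup>L M (f n) =
      of_real (prob {\<omega> \<in> space M. N \<omega> = n}) * (\<integral>\<omega>. u ^ S n \<omega> \<partial>M)" for n
  proof -
    have "indep_var borel ((\<lambda>m. indicator {n} m :: complex) \<circ> N) borel ((\<lambda>m. u ^ m) \<circ> S n)"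
      by (rule indep_var_compose[OF indep]) auto
    then have "integral\<^sup>L M (f n) =
        (\<integral>\<omega>. indicator {n} (N \<omega>) \<partial>M) * (\<integral>\<omega>. u ^ S n \<omega> \<partial>M)"
      unfolding f_def using u
      by (subst indep_var_lebesgue_integral[symmetric])
        (auto simp: comp_def indicator_def norm_power power_le_one
              intro!: integrable_const_bound[where B = 1])
    also have "(\<integral>\<omega>. indicator {n} (N \<omega>) \<partial>M) =
        (\<integral>\<omega>. complex_of_real (indicator {\<omega> \<in> space M. N \<omega> = n} \<omega>) \<partial>M)"
      by (rule Bochner_Integration.integral_cong) (auto simp: indicator_def)
    also have "\<dots> = of_real (prob {\<omega> \<in> space M. N \<omega> = n})"
      by (subst integral_complex_of_real) (simp add: Int_absorb2 subset_eq)
    finally show ?thesis .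
  qed
  ultimately show ?thesis by simp
qed

text \<open>Preimages under a constant are empty or the whole space, so a constant generates the
  trivial sigma-algebra, which is independent of everything.\<close>

lemma indep_var_const_right:
  assumes "random_variable S Y" "c \<in> space T"
  shows "indep_var S Y T (\<lambda>_. c)"
proof -
  have triv: "a \<in> {{}, space M}"
    if "a \<in> sigma_sets (space M) {(\<lambda>_. c) -` A \<inter> space M | A. A \<in> sets T}" for a
    using that
  proof induction
    case (Basic a)
    then show ?case by (auto split: if_splits)
  next
    case (Union a)
    then show ?case by (cases "\<exists>i. a i = space M") auto
  qed auto
  have ev: "a \<in> events" if "a \<in> sigma_sets (space M) {Y -` A \<inter> space M | A. A \<in> sets S}" for a
    using that assms(1) sets.sigma_sets_subset[of "{Y -` A \<inter> space M | A. A \<in> sets S}" M]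
    by (auto dest: measurable_sets)
  have "indep_set (sigma_sets (space M) {Y -` A \<inter> space M | A. A \<in> sets S})
      (sigma_sets (space M) {(\<lambda>_. c) -` A \<inter> space M | A. A \<in> sets T})"
  proof (rule indep_setI)
    fix a b
    assume a: "a \<in> sigma_sets (space M) {Y -` A \<inter> space M | A. A \<in> sets S}"
      and b: "b \<in> sigma_sets (space M) {(\<lambda>_. c) -` A \<inter> space M | A. A \<in> sets T}"
    from triv[OF b] show "prob (a \<inter> b) = prob a * prob b"
    proof (elim insertE emptyE)
      assume "b = space M"
      then show ?thesis using ev[OF a] by (simp add: prob_space)
    qed simp
  next
    show "sigma_sets (space M) {(\<lambda>_. c) -` A \<inter> space M | A. A \<in> sets T} \<subseteq> events"
    proof
      fix a assume "a \<in> sigma_sets (space M) {(\<lambda>_. c) -` A \<inter> space M | A. A \<in> sets T}"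
      from triv[OF this] show "a \<in> events" by (elim insertE emptyE) simp_all
    qed
  qed (rule subsetI, rule ev)
  with assms show ?thesis
    unfolding indep_var_eq by (intro conjI measurable_const)
qed

text \<open>The power series of a generating function is the random index expansion with the
  deterministic choice \<open>S n = n\<close>.\<close>

lemma pgf_sums:
  assumes "Y \<in> measurable M (count_space UNIV)" "norm u \<le> 1"
  shows "(\<lambda>n. of_real (prob {\<omega> \<in> space M. Y \<omega> = n}) * u ^ n) sums pgf M Y u"
proof -
  have "indep_var (count_space UNIV) Y (count_space UNIV) (\<lambda>_. n)" for n
    using assms(1) by (intro indep_var_const_right) auto
  from random_index_sums[where S = "\<lambda>n _. n", OF this assms(2)] show ?thesis
    by (simp add: pgf_def prob_space)
qed

text \<open>Both sides are sums of the same series, with the probabilities of \<open>N = n\<close>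
  as coefficients of \<open>w ^ n\<close>.\<close>

lemma pgf_random_index:
  fixes u w :: complex and N :: "'a \<Rightarrow> nat" and S :: "nat \<Rightarrow> 'a \<Rightarrow> nat"
  assumes indep: "\<And>n. indep_var (count_space UNIV) N (count_space UNIV) (S n)"
    and u: "norm u \<le> 1" and w: "norm w \<le> 1"
    and S: "\<And>n. pgf M (S n) u = w ^ n"
  shows "pgf M (\<lambda>\<omega>. S (N \<omega>) \<omega>) u = pgf M N w"
proof (rule sums_unique2)
  show "(\<lambda>n. of_real (prob {\<omega> \<in> space M. N \<omega> = n}) * w ^ n) sums pgf M N w"
    using indep w by (intro pgf_sums) (auto simp: indep_var_eq)
  show "(\<lambda>n. of_real (prob {\<omega> \<in> space M. N \<omega> = n}) * w ^ n) sums
      pgf M (\<lambda>\<omega>. S (N \<omega>) \<omega>) u"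
    using random_index_sums[OF indep u] S by (simp add: pgf_def)
qed

text \<open>Variables measurable with respect to the sigma-algebras of the two families generate
  sub-sigma-algebras of these, and independence is inherited by subsystems.\<close>

lemma independent_families_indep_var:
  assumes ind: "independent_families M I Y J Z"
    and f: "f \<in> measurable (sigma (space M) {Y i -` A \<inter> space M | i A. i \<in> I}) (count_space UNIV)"
    and g: "g \<in> measurable (sigma (space M) {Z i -` A \<inter> space M | i A. i \<in> J}) (count_space UNIV)"
  shows "indep_var (count_space UNIV) f (count_space UNIV) g"
proof -
  note ind' = ind[unfolded independent_families_def]
  have "f \<in> measurable M (count_space UNIV)" "g \<in> measurable M (count_space UNIV)"
    using vimage_in_generated_events[OF f] vimage_in_generated_events[OF g] indep_setD_ev1[OF ind'] indep_setD_ev2[OF ind']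
    by (auto intro!: measurableI)
  moreover have "indep_set (sigma_sets (space M) {f -` A \<inter> space M | A. A \<in> sets (count_space UNIV)})
     (sigma_sets (space M) {g -` A \<inter> space M | A. A \<in> sets (count_space UNIV)})"
    using sigma_sets_vimage_subset_generated_events[OF f] sigma_sets_vimage_subset_generated_events[OF g]
      indep_setD_ev1[OF ind'] indep_setD_ev2[OF ind']
    by (intro indep_setI indep_setD[OF ind']) blast+
  ultimately show ?thesis by (simp add: indep_var_eq)
qed

lemma independent_families_sym:
  assumes "independent_families M I Y J Z"
  shows "independent_families M J Z I Y"
  using assms unfolding independent_families_def indep_sets2_eq
  by (metis Int_commute mult.commute)

section \<open>Sums of iid variables and convolution powers\<close>

lemma iid_measurable:
  assumes "iid M X" "1 \<le> i"
  shows "X i \<in> measurable M (count_space UNIV)"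
  using assms by (auto simp: iid_def indep_vars_def)

lemma iid_prob_eq:
  assumes "iid M X" "1 \<le> i"
  shows "prob {\<omega> \<in> space M. X i \<omega> = n} = prob {\<omega> \<in> space M. X 1 \<omega> = n}"
proof -
  have "prob {\<omega> \<in> space M. X i \<omega> = n} = measure (distr M (count_space UNIV) (X i)) {n}"
    if "1 \<le> i" for i
    using iid_measurable[OF assms(1) that]
    by (subst measure_distr) (auto intro!: arg_cong[where f = prob])
  moreover have "distr M (count_space UNIV) (X i) = distr M (count_space UNIV) (X 1)"
    using assms unfolding iid_def by blast
  ultimately show ?thesis
    using assms(2) by (metis order_refl)
qed

text \<open>Equal laws give equal coefficients in the power series of
  \<open>pgf_sums\<close>.\<close>

lemma iid_pgf_eq:
  assumes "iid M X" "1 \<le> i" "norm u \<le> 1"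
  shows "pgf M (X i) u = pgf M (X 1) u"
  using pgf_sums[OF iid_measurable[OF assms(1,2)] assms(3)]
    pgf_sums[OF iid_measurable[OF assms(1), of 1] assms(3)]
  unfolding iid_prob_eq[OF assms(1,2)] by (auto dest: sums_unique2)

lemma iid_pgf_sum:
  assumes "iid M X" "norm u \<le> 1"
  shows "pgf M (\<lambda>\<omega>. \<Sum>i=1..n. X i \<omega>) u = pgf M (X 1) u ^ n"
proof -
  have ind: "indep_vars (\<lambda>_. count_space UNIV) X {1..n}"
    using assms(1) by (auto simp: iid_def intro: indep_vars_subset)
  have ind': "indep_vars (\<lambda>_. borel) (\<lambda>i \<omega>. u ^ X i \<omega>) {1..n}"
    by (rule indep_vars_compose2[OF ind]) simp
  have "pgf M (\<lambda>\<omega>. \<Sum>i=1..n. X i \<omega>) u = (\<integral>\<omega>. (\<Prod>i=1..n. u ^ X i \<omega>) \<partial>M)"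
    by (simp add: pgf_def power_sum)
  also have "\<dots> = (\<Prod>i=1..n. pgf M (X i) u)"
    unfolding pgf_def using ind' assms(2) iid_measurable[OF assms(1)]
    by (intro indep_vars_lebesgue_integral integrable_power) auto
  also have "\<dots> = pgf M (X 1) u ^ n"
    by (subst prod.cong[OF refl iid_pgf_eq[OF assms(1) _ assms(2)]]) simp_all
  finally show ?thesis .
qed

text \<open>The event is partitioned by the vector of values of \<open>X 1\<close>, ...,
  \<open>X j\<close>, which ranges over the weak compositions of \<open>i\<close>; independence
  turns each piece into a product.\<close>

lemma iid_prob_sum:
  assumes X: "iid M X" and j: "1 \<le> j"
  shows "prob {\<omega> \<in> space M. (\<Sum>m=1..j. X m \<omega>) = i} =
    conv_power (\<lambda>i. prob {\<omega> \<in> space M. X 1 \<omega> = i}) j i"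
proof -
  let ?A = "\<lambda>r. \<Inter>m\<in>{1..j}. X m -` {r m} \<inter> space M"
  have [measurable]: "X m \<in> measurable M (count_space UNIV)" if "m \<in> {1..j}" for m
    using iid_measurable[OF X] that by simp
  \<comment> \<open>For \<open>j = 0\<close> the intersection would be \<open>UNIV\<close> rather
    than \<open>space M\<close>, hence the assumption \<open>1 \<le> j\<close>.\<close>
  have ev: "?A r \<in> events" for r
    using j by (intro sets.finite_INT) auto
  have disj: "disjoint_family_on ?A (weak_compositions j i)"
    unfolding disjoint_family_on_def
  proof safe
    fix r s \<omega> assume *: "r \<in> weak_compositions j i" "s \<in> weak_compositions j i" "r \<noteq> s"
      "\<omega> \<in> ?A r" "\<omega> \<in> ?A s"
    have "r = s"
      \<comment> \<open>Both \<open>r\<close> and \<open>s\<close> agree with the values of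
        \<open>X\<close> at \<omega> on \<open>{1..j}\<close>, and extensionality fixes them
        elsewhere.\<close>
      using * by (intro PiE_ext[of _ "{1..j}" "\<lambda>_. UNIV"]) (auto simp: weak_compositions_def)
    with * show "\<omega> \<in> {}" by simp
  qed
  have "{\<omega> \<in> space M. (\<Sum>m=1..j. X m \<omega>) = i} = (\<Union>r\<in>weak_compositions j i. ?A r)"
  proof safe
    fix \<omega> assume "\<omega> \<in> space M"
    then show "\<omega> \<in> (\<Union>r\<in>weak_compositions j (\<Sum>m=1..j. X m \<omega>). ?A r)"
      by (intro UN_I[of "restrict (\<lambda>m. X m \<omega>) {1..j}"]) (auto simp: weak_compositions_def)
  qed (use j in \<open>auto simp: weak_compositions_def intro!: sum.cong\<close>)
  then have "prob {\<omega> \<in> space M. (\<Sum>m=1..j. X m \<omega>) = i} = (\<Sum>r\<in>weak_compositions j i. prob (?A r))"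
    by (simp only:) (intro finite_measure_finite_Union finite_weak_compositions disj, use ev in blast)
  also have "\<dots> = (\<Sum>r\<in>weak_compositions j i. \<Prod>m=1..j. prob {\<omega> \<in> space M. X 1 \<omega> = r m})"
  proof (rule sum.cong[OF refl])
    fix r
    have "prob (?A r) = (\<Prod>m=1..j. prob (X m -` {r m} \<inter> space M))"
      using X j by (intro indep_varsD[where I = "{1..}"]) (auto simp: iid_def)
    also have "\<dots> = (\<Prod>m=1..j. prob {\<omega> \<in> space M. X 1 \<omega> = r m})"
    proof (rule prod.cong[OF refl])
      fix m assume "m \<in> {1..j}"
      then show "prob (X m -` {r m} \<inter> space M) = prob {\<omega> \<in> space M. X 1 \<omega> = r m}"
        using iid_prob_eq[OF X, of m "r m"] by (simp add: vimage_def Int_def conj_commute)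
    qed
    finally show "prob (?A r) = (\<Prod>m=1..j. prob {\<omega> \<in> space M. X 1 \<omega> = r m})" .
  qed
  finally show ?thesis by (simp add: conv_power_def)
qed

text \<open>The law of \<open>X 1 + ... + X j\<close> is the convolution power, while its generating
  function is the \<open>j\<close>-th power of that of \<open>X 1\<close>.\<close>

lemma iid_conv_power_sums:
  assumes X: "iid M X" and j: "1 \<le> j" and u: "norm u \<le> 1"
  shows "(\<lambda>i. of_real (conv_power (\<lambda>i. prob {\<omega> \<in> space M. X 1 \<omega> = i}) j i) * u ^ i)
    sums (pgf M (X 1) u ^ j)"
proof -
  have "(\<lambda>\<omega>. \<Sum>m=1..j. X m \<omega>) \<in> measurable M (count_space UNIV)"
    using iid_measurable[OF X] by (intro measurable_sum_count_space) auto
  from pgf_sums[OF this u] show ?thesis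
    by (simp only: iid_prob_sum[OF X j] iid_pgf_sum[OF X u])
qed

lemma iid_conv_power_suminf:
  assumes X: "iid M X" and j: "1 \<le> j" and u: "norm u \<le> 1"
  shows "(\<Sum>i. of_real (conv_power (\<lambda>i. prob {\<omega> \<in> space M. X 1 \<omega> = i}) j (Suc i)) * (1 - u ^ Suc i))
    = 1 - pgf M (X 1) u ^ j"
proof -
  let ?c = "conv_power (\<lambda>i. prob {\<omega> \<in> space M. X 1 \<omega> = i}) j"
  have "pgf M (X 1) 1 = 1"
    by (simp add: pgf_def prob_space)
  then have "(\<lambda>i. of_real (?c i) * (1 - u ^ i)) sums (1 - pgf M (X 1) u ^ j)"
    \<comment> \<open>The instance \<open>u = 1\<close> says that the convolution power has total
      mass 1.\<close>
    using sums_diff[OF iid_conv_power_sums[OF X j, of 1] iid_conv_power_sums[OF X j u]]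
    by (simp add: algebra_simps)
  then have "(\<lambda>i. of_real (?c (Suc i)) * (1 - u ^ Suc i)) sums (1 - pgf M (X 1) u ^ j)"
    \<comment> \<open>The term at index 0 vanishes because \<open>1 - u ^ 0 = 0\<close>, so the
      series may start at 1.\<close>
    using sums_Suc_iff[of "\<lambda>i. of_real (?c i) * (1 - u ^ i)"] by simp
  then show ?thesis
    by (rule sums_unique[symmetric])
qed

end

section \<open>Generating function of the compound iterated process\<close>

theorem proposition4p2:
  fixes P :: "'a measure"
    and M\<^sub>0 M :: "real \<Rightarrow> 'a \<Rightarrow> nat"
    and k\<^sub>0 k :: nat
    and \<mu> lam \<alpha> :: "nat \<Rightarrow> real"
    and X :: "nat \<Rightarrow> 'a \<Rightarrow> nat"
    and D :: "real \<Rightarrow> 'a \<Rightarrow> nat"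
    and t :: real
    and u :: complex
  assumes "prob_space P"
    and "generalized_counting_process P k\<^sub>0 \<mu> M\<^sub>0"
    and "generalized_counting_process P k lam M"
    and "independent_families P {0..} M\<^sub>0 {0..} M"
    and "iid P X"
    and "independent_families P {1..} X {0..} (iterated_process M M\<^sub>0)"
    and "\<And>i. measure P {\<omega> \<in> space P. X 1 \<omega> = i} = \<alpha> i"
    and "\<And>s \<omega>. D s \<omega> = (\<Sum>i=1..iterated_process M M\<^sub>0 s \<omega>. X i \<omega>)"
    and "0 \<le> t"
    and "norm u \<le> 1"
  shows "pgf P (D t) u =
    exp (- of_real t * (\<Sum>j\<^sub>0=1..k\<^sub>0. of_real (\<mu> j\<^sub>0) *
      (1 - exp (- of_nat j\<^sub>0 * (\<Sum>j=1..k. of_real (lam j) *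
        (\<Sum>i. of_real (conv_power \<alpha> j (Suc i)) * (1 - u ^ Suc i)))))))"
proof -
  interpret prob_space P by fact
  define g where "g = pgf P (X 1) u"
  \<comment> \<open>This is the generating function of \<open>M 1\<close> at \<open>g\<close>; being
    an expectation of powers of \<open>g\<close>, it lies in the unit disc.\<close>
  define w where "w = exp (- (\<Sum>j=1..k. of_real (lam j) * (1 - g ^ j)))"
  have \<alpha>: "\<alpha> = (\<lambda>i. prob {\<omega> \<in> space P. X 1 \<omega> = i})"
    using assms(7) by auto
  have M\<^sub>0: "pgf P (M\<^sub>0 s) v = exp (- of_real s * (\<Sum>j=1..k\<^sub>0. of_real (\<mu> j) * (1 - v ^ j)))"
    if "0 \<le> s" "norm v \<le> 1" for s v
    using assms(2) that by (auto simp: generalized_counting_process_def)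
  have M: "pgf P (M s) v = exp (- of_real s * (\<Sum>j=1..k. of_real (lam j) * (1 - v ^ j)))"
    if "0 \<le> s" "norm v \<le> 1" for s v
    using assms(3) that by (auto simp: generalized_counting_process_def)
  have g: "norm g \<le> 1"
    unfolding g_def pgf_def by (rule norm_expectation_power_le_1) fact
  have w: "norm w \<le> 1"
    using norm_expectation_power_le_1[OF g, of "M 1"] M[OF _ g, of 1] by (simp add: w_def pgf_def)
  have "pgf P (D t) u = pgf P (\<lambda>\<omega>. \<Sum>i=1..iterated_process M M\<^sub>0 t \<omega>. X i \<omega>) u"
    by (simp add: assms(8) pgf_def)
  also have "\<dots> = pgf P (iterated_process M M\<^sub>0 t) g"
  \<comment> \<open>First conditioning: the index is the iterated process at time \<open>t\<close>,
    and \<open>S n\<close> is the partial sum of \<open>X\<close>.\<close>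
  proof (rule pgf_random_index[OF _ assms(10) g])
    show "indep_var (count_space UNIV) (iterated_process M M\<^sub>0 t)
        (count_space UNIV) (\<lambda>\<omega>. \<Sum>i=1..n. X i \<omega>)" for n
    proof (rule independent_families_indep_var[OF independent_families_sym[OF assms(6)]])
      show "iterated_process M M\<^sub>0 t \<in> measurable (sigma (space P)
          {iterated_process M M\<^sub>0 i -` A \<inter> space P | i A. i \<in> {0..}}) (count_space UNIV)"
        using assms(9) by (intro measurable_sigma_family) simp
    qed (intro measurable_sum_count_space measurable_sigma_family, simp)
    show "pgf P (\<lambda>\<omega>. \<Sum>i=1..n. X i \<omega>) u = g ^ n" for n
      unfolding g_def using assms(5,10) by (rule iid_pgf_sum)
  qed
  also have "\<dots> = pgf P (M\<^sub>0 t) w"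
    unfolding iterated_process_def
  \<comment> \<open>Second conditioning: the index is \<open>M\<^sub>0 t\<close> and
    \<open>S n = M (real n)\<close>. Since the exponent is linear in time, the value at time
    \<open>n\<close> is the \<open>n\<close>-th power of the value at time 1.\<close>
  proof (rule pgf_random_index[OF _ g w])
    show "indep_var (count_space UNIV) (M\<^sub>0 t) (count_space UNIV) (M (real n))" for n
      using assms(9) by (intro independent_families_indep_var[OF assms(4)] measurable_sigma_family) auto
    show "pgf P (M (real n)) g = w ^ n" for n
      using M[OF _ g, of "real n"] by (simp add: w_def exp_of_nat_mult[symmetric])
  qed
  also have "\<dots> = exp (- of_real t * (\<Sum>j\<^sub>0=1..k\<^sub>0. of_real (\<mu> j\<^sub>0) * (1 - w ^ j\<^sub>0)))"
    using M\<^sub>0[OF assms(9) w] .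
  \<comment> \<open>Each \<open>1 - g ^ j\<close> is expanded into its series over convolution
    powers; the summation range supplies \<open>1 \<le> j\<close>.\<close>
  also have "w = exp (- (\<Sum>j=1..k. of_real (lam j) *
        (\<Sum>i. of_real (conv_power \<alpha> j (Suc i)) * (1 - u ^ Suc i))))"
    unfolding w_def \<alpha> g_def using iid_conv_power_suminf[OF assms(5) _ assms(10)]
    by (intro arg_cong[where f = exp] arg_cong[where f = uminus] sum.cong) auto
  finally show ?thesis
    \<comment> \<open>The power \<open>w ^ j\<^sub>0\<close> becomes the factor
      \<open>j\<^sub>0\<close> inside the inner exponential.\<close>
    by (simp only: exp_of_nat_mult[symmetric] mult_minus_left mult_minus_right)
qed

end
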